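(* Let $(A,B)$ be a table algebra. Suppose that $A$ has a character $\chi$ with $K(\chi)=\{1_A\}$ such that $\frac{\chi(b)}{|b|}$ takes on exactly $k$ different values as $b$ ranges over $B$. If all powers of $\chi$ are characters of $A$, then each irreducible character of $A$ appears as an irreducible component of one of $\chi^i$, $0\leq i\leq k-1$, where $\chi^0=\rho$ is the degree map, $\rho(b)=|b|$ for $b\in B$.
   Context: A table algebra $(A,B)$ (not necessarily commutative) is a finite-dimensional associative unital algebra $A$ over $\mathbb{C}$ with a distinguished basis $B=\{b_1=1_A,\dots,b_d\}$ such that: (I) for $a,b\in B$, $ab=\sum_{c\in B}\lambda_{abc}c$ with all $\lambda_{abc}$ nonnegative real numbers; (II) there is a semilinear (conjugate-linear) involutory anti-automorphism $^*$ of $A$ with $B^*=B$; (III) for $a,b\in B$, $\lambda_{ab1_A}=\delta_{ab^*}|a|$ with $|a|>0$, where $\delta_{ab^*}$ is $1$ if $a=b^*$ and $0$ otherwise; (IV) the map $b\mapsto|b|$, $b\in B$, extends linearly to a one-dimensional representation of $A$ (the degree map), and $|b|=|b^*|$ for all $b\in B$. A character of $A$ is the trace function $A\to\mathbb{C}$ of a finite-dimensional representation of $A$; it is irreducible if the representation is irreducible. An irreducible character $\psi$ is an irreducible component (constituent) of a character $\theta$ if it occurs with positive multiplicity when $\theta$ is written as a sum of irreducible characters. For characters (or linear functionals) $\chi,\psi$ on $A$, the product $\chi\psi$ is the linear functional on $A$ defined by $\chi\psi(b)=\frac{1}{|b|}\chi(b)\psi(b)$ for $b\in B$; it need not be a character.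 Powers are taken with respect to this product, so $\chi^j(b)=\frac{1}{|b|^{j-1}}\chi(b)^j$ for $b\in B$. For a character $\chi$ of $A$, $K(\chi)=\{b\in B:\chi(b)=|b|\chi(1_A)\}$. *)

theory Defs
  imports
    Complex_Main
    "HOL-Library.Multiset"
    "HOL-Library.Nonpos_Ints"
    "Jordan_Normal_Form.Matrix"
begin

section \<open>Complex algebras, representations and characters\<close>

locale complex_algebra = vector_space scale
  for scale :: "complex \<Rightarrow> 'a::ring_1 \<Rightarrow> 'a" (infixr "*\<^sub>A" 75) +
  assumes scale_mult_left: "(c *\<^sub>A x) * y = c *\<^sub>A (x * y)"
    and scale_mult_right: "x * (c *\<^sub>A y) = c *\<^sub>A (x * y)"

definition mat_trace :: "'b::comm_monoid_add mat \<Rightarrow> 'b" where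
  "mat_trace M = (\<Sum>i<dim_row M. M $$ (i, i))"

context complex_algebra
begin

text \<open>
  Representations on \<open>n\<close>-dimensional complex spaces are given, after a choice of basis of the
  space, by unital algebra homomorphisms into the \<open>n \<times> n\<close> matrices.  The case \<open>n = 0\<close> is allowed;
  it is excluded for irreducible representations.
\<close>

definition representation_of_degree :: "nat \<Rightarrow> ('a \<Rightarrow> complex mat) \<Rightarrow> bool" where
  "representation_of_degree n R \<longleftrightarrow>
     (\<forall>x. R x \<in> carrier_mat n n) \<and>
     (\<forall>x y. R (x + y) = R x + R y) \<and>
     (\<forall>c x. R (c *\<^sub>A x) = c \<cdot>\<^sub>m R x) \<and>
     (\<forall>x y. R (x * y) = R x * R y) \<and>
     R 1 = 1\<^sub>m n"

definition invariant_subspace :: "nat \<Rightarrow> ('a \<Rightarrow> complex mat) \<Rightarrow> complex vec set \<Rightarrow> bool" where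
  "invariant_subspace n R W \<longleftrightarrow>
     W \<subseteq> carrier_vec n \<and> 0\<^sub>v n \<in> W \<and>
     (\<forall>v\<in>W. \<forall>w\<in>W. v + w \<in> W) \<and>
     (\<forall>c. \<forall>v\<in>W. c \<cdot>\<^sub>v v \<in> W) \<and>
     (\<forall>x. \<forall>v\<in>W. R x *\<^sub>v v \<in> W)"

definition irreducible_representation :: "nat \<Rightarrow> ('a \<Rightarrow> complex mat) \<Rightarrow> bool" where
  "irreducible_representation n R \<longleftrightarrow>
     representation_of_degree n R \<and> n > 0 \<and>
     (\<forall>W. invariant_subspace n R W \<longrightarrow> W = {0\<^sub>v n} \<or> W = carrier_vec n)"

definition character :: "('a \<Rightarrow> complex) \<Rightarrow> bool" where
  "character \<chi> \<longleftrightarrow> (\<exists>n R. representation_of_degree n R \<and> \<chi> = (\<lambda>x. mat_trace (R x)))"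

definition irreducible_character :: "('a \<Rightarrow> complex) \<Rightarrow> bool" where
  "irreducible_character \<psi> \<longleftrightarrow>
     (\<exists>n R. irreducible_representation n R \<and> \<psi> = (\<lambda>x. mat_trace (R x)))"

text \<open>The multiset \<open>M\<close> records the irreducible characters with their multiplicities.\<close>

definition irreducible_component :: "('a \<Rightarrow> complex) \<Rightarrow> ('a \<Rightarrow> complex) \<Rightarrow> bool" where
  "irreducible_component \<psi> \<theta> \<longleftrightarrow>
     (\<exists>M. (\<forall>\<phi>\<in>#M. irreducible_character \<phi>) \<and>
          \<theta> = (\<lambda>x. \<Sum>\<phi>\<in>#M. \<phi> x) \<and> count M \<psi> > 0)"

definition linear_extension :: "'a set \<Rightarrow> ('a \<Rightarrow> complex) \<Rightarrow> 'a \<Rightarrow> complex" where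
  "linear_extension B f x = (\<Sum>b\<in>B. representation B x b * f b)"

end

section \<open>Table algebras\<close>

text \<open>
  The structure constant \<open>\<lambda>\<^sub>a\<^sub>b\<^sub>c\<close> is \<open>representation B (a * b) c\<close>, the coordinate of \<open>a * b\<close> at the
  basis element \<open>c\<close>, and \<open>deg b\<close> is \<open>|b|\<close>.  Only the values of \<open>deg\<close> on \<open>B\<close> matter.
\<close>

locale table_algebra = complex_algebra scale + finite_dimensional_vector_space scale B
  for scale :: "complex \<Rightarrow> 'a::ring_1 \<Rightarrow> 'a" (infixr "*\<^sub>A" 75) and B :: "'a set" +
  fixes star :: "'a \<Rightarrow> 'a" and deg :: "'a \<Rightarrow> real"
  assumes one_in_basis: "1 \<in> B"
    and structure_constants_nonneg:
      "\<lbrakk>a \<in> B; b \<in> B; c \<in> B\<rbrakk> \<Longrightarrow> representation B (a * b) c \<in> \<real>\<^sub>\<ge>\<^sub>0"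
    and star_add: "star (x + y) = star x + star y"
    and star_scale: "star (r *\<^sub>A x) = cnj r *\<^sub>A star x"
    and star_mult: "star (x * y) = star y * star x"
    and star_star: "star (star x) = x"
    and star_basis: "star ` B = B"
    and structure_constant_one:
      "\<lbrakk>a \<in> B; b \<in> B\<rbrakk> \<Longrightarrow>
         representation B (a * b) 1 = (if a = star b then complex_of_real (deg a) else 0)"
    and deg_pos: "b \<in> B \<Longrightarrow> deg b > 0"
    and degree_representation:
      "representation_of_degree 1
         (\<lambda>x. mat 1 1 (\<lambda>_. linear_extension B (\<lambda>b. complex_of_real (deg b)) x))"
    and deg_star: "b \<in> B \<Longrightarrow> deg (star b) = deg b"
begin

definition degree_map :: "'a \<Rightarrow> complex" where
  "degree_map = linear_extension B (\<lambda>b. complex_of_real (deg b))"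

definition char_prod :: "('a \<Rightarrow> complex) \<Rightarrow> ('a \<Rightarrow> complex) \<Rightarrow> 'a \<Rightarrow> complex" where
  "char_prod \<chi> \<psi> = linear_extension B (\<lambda>b. 1 / complex_of_real (deg b) * \<chi> b * \<psi> b)"

primrec char_power :: "('a \<Rightarrow> complex) \<Rightarrow> nat \<Rightarrow> 'a \<Rightarrow> complex" where
  "char_power \<chi> 0 = degree_map"
| "char_power \<chi> (Suc j) = char_prod (char_power \<chi> j) \<chi>"

definition char_kernel :: "('a \<Rightarrow> complex) \<Rightarrow> 'a set" where
  "char_kernel \<chi> = {b \<in> B. \<chi> b = complex_of_real (deg b) * \<chi> 1}"

lemma linear_extension_basis:
  assumes "b \<in> B"
  shows "linear_extension B f b = f b"
proof -
  have "linear_extension B f b = (\<Sum>c\<in>B. if c = b then f c else 0)"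
    unfolding linear_extension_def
    by (rule sum.cong) (simp_all add: representation_basis[OF independent_Basis assms])
  then show ?thesis
    using assms finite_Basis by simp
qed

text \<open>For \<open>j = Suc i\<close> this is \<open>\<chi> b ^ j / |b| ^ (j - 1)\<close>.\<close>

lemma char_power_basis:
  assumes "b \<in> B"
  shows "char_power \<chi> j b = complex_of_real (deg b) * (\<chi> b / complex_of_real (deg b)) ^ j"
proof (induction j)
  case 0
  then show ?case
    by (simp add: degree_map_def linear_extension_basis[OF assms])
next
  case (Suc j)
  then show ?case
    by (simp add: char_prod_def linear_extension_basis[OF assms])
qed

end

end

theory Submission
  imports Defs "Jordan_Normal_Form.Determinant"
begin

text \<open>
  Write \<open>\<alpha> b = \<chi> b / |b|\<close>, so that \<open>\<chi>\<^sup>i b = |b| * \<alpha> b ^ i\<close> on the basis. The condition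
  \<open>K(\<chi>) = {1}\<close> says that \<open>\<alpha>\<close> takes the value \<open>\<alpha> 1\<close> at \<open>1\<close> only. Hence a polynomial of degree
  \<open>k - 1\<close> that is \<open>1\<close> at \<open>\<alpha> 1\<close> and \<open>0\<close> at the other \<open>k - 1\<close> values of \<open>\<alpha>\<close> has coefficients \<open>c\<^sub>i\<close>
  for which \<open>\<Sum>i<k. c\<^sub>i \<chi>\<^sup>i\<close> is the functional \<open>\<tau>\<close> that reads off the coordinate at the basis
  element \<open>1\<close> (\<open>coordinate_at_one_as_combination_of_powers\<close>). Because \<open>\<tau> (x * star b)\<close> is \<open>|b|\<close>
  times the coordinate of \<open>x\<close> at \<open>b\<close>, the bilinear form \<open>\<tau> (x * y)\<close> is nondegenerate
  (\<open>coordinate_at_one_nondegenerate\<close>).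

  Suppose that the irreducible character \<open>\<psi>\<close>, afforded by \<open>R\<close>, is a component of none of the
  powers \<open>\<chi>\<^sup>i\<close> with \<open>i < k\<close>. Each of these powers is a character, hence a sum of irreducible
  characters (\<open>trace_is_sum_of_irreducible_characters\<close>), all different from \<open>\<psi>\<close>. There is an
  element \<open>x\<close> with \<open>R x \<noteq> 0\<close> that is killed by every irreducible representation whose character
  is not \<open>\<psi>\<close> (\<open>irreducible_separating_element\<close>). Then \<open>\<chi>\<^sup>i (x * y) = 0\<close> for all \<open>y\<close> and all
  \<open>i < k\<close>, so \<open>\<tau> (x * y) = 0\<close> for all \<open>y\<close>, and nondegeneracy gives \<open>x = 0\<close>, contradicting
  \<open>R x \<noteq> 0\<close>. The separating element lies in a left ideal that is minimal among those not
  contained in the kernel of \<open>R\<close>.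
\<close>

section \<open>Traces and idempotents of complex matrices\<close>

lemma mat_trace_mult_commute:
  fixes A B :: "'b::comm_semiring_0 mat"
  assumes "A \<in> carrier_mat n m" and "B \<in> carrier_mat m n"
  shows "mat_trace (A * B) = mat_trace (B * A)"
proof -
  have "mat_trace (A * B) = (\<Sum>i<n. \<Sum>j<m. A $$ (i, j) * B $$ (j, i))"
    using assms by (simp add: mat_trace_def scalar_prod_def atLeast0LessThan)
  also have "\<dots> = (\<Sum>j<m. \<Sum>i<n. B $$ (j, i) * A $$ (i, j))"
    by (subst sum.swap) (simp add: mult.commute)
  also have "\<dots> = mat_trace (B * A)"
    using assms by (simp add: mat_trace_def scalar_prod_def atLeast0LessThan)
  finally show ?thesis .
qed

lemma mat_trace_one: "mat_trace (1\<^sub>m n :: complex mat) = of_nat n"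
  by (simp add: mat_trace_def)

lemma mat_trace_add:
  fixes A B :: "'b::comm_monoid_add mat"
  assumes "A \<in> carrier_mat n n" and "B \<in> carrier_mat n n"
  shows "mat_trace (A + B) = mat_trace A + mat_trace B"
  using assms by (simp add: mat_trace_def sum.distrib)

lemma mat_eq_if_mult_vec_eq:
  fixes A B :: "'b::semiring_1 mat"
  assumes A: "A \<in> carrier_mat n m" and B: "B \<in> carrier_mat n m"
    and eq: "\<And>v. v \<in> carrier_vec m \<Longrightarrow> A *\<^sub>v v = B *\<^sub>v v"
  shows "A = B"
proof (rule eq_matI)
  fix i j assume i: "i < dim_row B" and j: "j < dim_col B"
  have entry: "(M *\<^sub>v unit_vec m j) $ i = M $$ (i, j)" if "M \<in> carrier_mat n m" for M :: "'b mat"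
    using that i j B by simp
  show "A $$ (i, j) = B $$ (i, j)"
    using eq[of "unit_vec m j"] entry[OF A] entry[OF B] by simp
qed (use A B in auto)

lemma mult_mat_zero_vec:
  fixes A :: "'b::semiring_1 mat"
  assumes "A \<in> carrier_mat n m"
  shows "A *\<^sub>v 0\<^sub>v m = 0\<^sub>v n"
  using assms by (intro eq_vecI) auto

lemma zero_mat_mult_vec:
  fixes v :: "'b::semiring_1 vec"
  assumes "v \<in> carrier_vec m"
  shows "0\<^sub>m n m *\<^sub>v v = 0\<^sub>v n"
  using assms by (intro eq_vecI) auto

lemma nonzero_mat_obtain_vec:
  fixes A :: "'b::semiring_1 mat"
  assumes A: "A \<in> carrier_mat n m" and nonzero: "A \<noteq> 0\<^sub>m n m"
  obtains v where "v \<in> carrier_vec m" and "A *\<^sub>v v \<noteq> 0\<^sub>v n"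
proof (rule ccontr)
  assume "\<not> thesis"
  then have "A = 0\<^sub>m n m"
    using that by (intro mat_eq_if_mult_vec_eq[OF A zero_carrier_mat]) (auto simp: zero_mat_mult_vec)
  then show False using nonzero by contradiction
qed

text \<open>
  If \<open>m > n\<close>, padding both factors with zeros to \<open>m \<times> m\<close> matrices does not change the product
  \<open>P' * P\<close>. The padded factors would then be mutually inverse, but the padded \<open>P\<close> has a zero row.
\<close>

lemma left_invertible_mat_dim_le:
  fixes P :: "'b::field mat"
  assumes P: "P \<in> carrier_mat n m" and P': "P' \<in> carrier_mat m n" and inv: "P' * P = 1\<^sub>m m"
  shows "m \<le> n"
proof (rule ccontr)
  assume "\<not> m \<le> n"
  then have nm: "n < m" by simp
  define Z where "Z = mat m m (\<lambda>(i, j). if i < n then P $$ (i, j) else 0)"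
  define Z' where "Z' = mat m m (\<lambda>(i, j). if j < n then P' $$ (i, j) else 0)"
  have "Z' * Z = P' * P"
  proof (rule eq_matI)
    fix i j assume "i < dim_row (P' * P)" "j < dim_col (P' * P)"
    then have ij: "i < m" "j < m" using P P' by auto
    have "(Z' * Z) $$ (i, j) = (\<Sum>l<m. if l < n then P' $$ (i, l) * P $$ (l, j) else 0)"
      using ij by (auto simp: Z_def Z'_def scalar_prod_def atLeast0LessThan intro!: sum.cong)
    also have "\<dots> = (\<Sum>l<n. P' $$ (i, l) * P $$ (l, j))"
      using nm by (intro sum.mono_neutral_cong_right) auto
    also have "\<dots> = (P' * P) $$ (i, j)"
      using ij P P' by (simp add: scalar_prod_def atLeast0LessThan)
    finally show "(Z' * Z) $$ (i, j) = (P' * P) $$ (i, j)" .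
  qed (use P P' in \<open>auto simp: Z_def Z'_def\<close>)
  then have "Z * Z' = 1\<^sub>m m"
    using inv by (intro mat_mult_left_right_inverse[of Z' m Z]) (auto simp: Z_def Z'_def)
  moreover have "(Z * Z') $$ (n, n) = 0"
    using nm by (simp add: Z_def Z'_def scalar_prod_def)
  ultimately show False
    using nm by simp
qed

text \<open>
  The columns of \<open>P\<close> form a basis of \<open>W\<close>, and \<open>P'\<close> gives the coordinates in it, so that \<open>P * P'\<close>
  is a projection onto \<open>W\<close>. Take such a pair with as many columns as possible; their number is at
  most \<open>n\<close>. If \<open>P * P'\<close> moved some \<open>w \<in> W\<close>, then \<open>u = w - P P' w\<close> would be a nonzero vector of
  \<open>W\<close> annihilated by \<open>P'\<close>, and could serve as one more column.
\<close>

lemma subspace_frame: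
  fixes W :: "complex vec set"
  assumes sub: "W \<subseteq> carrier_vec n" and zero: "0\<^sub>v n \<in> W"
    and add: "\<And>v w. v \<in> W \<Longrightarrow> w \<in> W \<Longrightarrow> v + w \<in> W"
    and smult: "\<And>c v. v \<in> W \<Longrightarrow> c \<cdot>\<^sub>v v \<in> W"
  obtains m P P' where "P \<in> carrier_mat n m" and "P' \<in> carrier_mat m n" and "P' * P = 1\<^sub>m m"
    and "\<And>v. v \<in> carrier_vec m \<Longrightarrow> P *\<^sub>v v \<in> W"
    and "\<And>w. w \<in> W \<Longrightarrow> P *\<^sub>v (P' *\<^sub>v w) = w"
proof -
  define F where "F m P P' \<longleftrightarrow> P \<in> carrier_mat n m \<and> P' \<in> carrier_mat m n \<and> P' * P = 1\<^sub>m m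
      \<and> (\<forall>v\<in>carrier_vec m. P *\<^sub>v v \<in> W)" for m P P'
  have "F 0 (0\<^sub>m n 0) (0\<^sub>m 0 n)"
  proof -
    have "0\<^sub>m n 0 *\<^sub>v v = 0\<^sub>v n" if "v \<in> carrier_vec 0" for v :: "complex vec"
      using that by (intro eq_vecI) (auto simp: scalar_prod_def)
    then show ?thesis
      using zero by (auto simp: F_def)
  qed
  then have ex: "\<exists>P P'. F 0 P P'" by blast
  have bound: "\<forall>l. (\<exists>P P'. F l P P') \<longrightarrow> l \<le> n"
    using left_invertible_mat_dim_le unfolding F_def by blast
  define m where "m = (GREATEST l. \<exists>P P'. F l P P')"
  have max: "l \<le> m" if "F l P P'" for l P P'
    unfolding m_def using that bound by (intro Greatest_le_nat[of _ l n]) blast+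
  have "\<exists>P P'. F m P P'"
    unfolding m_def by (rule GreatestI_nat[where k = 0 and b = n]) (use ex bound in blast)+
  then obtain P P' where F: "F m P P'" by blast
  then have P: "P \<in> carrier_mat n m" and P': "P' \<in> carrier_mat m n" and inv: "P' * P = 1\<^sub>m m"
    and PW: "\<And>v. v \<in> carrier_vec m \<Longrightarrow> P *\<^sub>v v \<in> W"
    by (auto simp: F_def)
  have "P *\<^sub>v (P' *\<^sub>v w) = w" if w: "w \<in> W" for w
  proof (rule ccontr)
    assume neq: "P *\<^sub>v (P' *\<^sub>v w) \<noteq> w"
    have wc: "w \<in> carrier_vec n" using w sub by blast
    have P'w: "P' *\<^sub>v w \<in> carrier_vec m" using P' wc by simp
    have PP'w: "P *\<^sub>v (P' *\<^sub>v w) \<in> carrier_vec n" using P P'w by simp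
    define u where "u = w + (-1) \<cdot>\<^sub>v (P *\<^sub>v (P' *\<^sub>v w))"
    have uW: "u \<in> W"
      unfolding u_def using w add smult PW[OF P'w] by blast
    then have uc: "u \<in> carrier_vec n" using sub by blast
    have "P' *\<^sub>v (P *\<^sub>v (P' *\<^sub>v w)) = P' *\<^sub>v w"
      using assoc_mult_mat_vec[OF P' P P'w] inv P'w by simp
    then have "P' *\<^sub>v u = P' *\<^sub>v w + (-1) \<cdot>\<^sub>v (P' *\<^sub>v w)"
      unfolding u_def
      using mult_add_distrib_mat_vec[OF P' wc, of "(-1) \<cdot>\<^sub>v (P *\<^sub>v (P' *\<^sub>v w))"]
        mult_mat_vec[OF P' PP'w, of "-1"] PP'w
      by simp
    moreover have "x + (-1) \<cdot>\<^sub>v x = 0\<^sub>v m" if "x \<in> carrier_vec m" for x :: "complex vec"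
      using that by (intro eq_vecI) auto
    ultimately have P'u: "P' *\<^sub>v u = 0\<^sub>v m"
      using P'w by simp
    have "\<exists>i<n. u $ i \<noteq> 0"
    proof (rule ccontr)
      assume "\<not> (\<exists>i<n. u $ i \<noteq> 0)"
      moreover have "z = w" if "z \<in> carrier_vec n" "\<not> (\<exists>i<n. (w + (-1) \<cdot>\<^sub>v z) $ i \<noteq> 0)" for z
        using that wc by (intro eq_vecI) auto
      ultimately have "P *\<^sub>v (P' *\<^sub>v w) = w"
        using PP'w unfolding u_def by blast
      then show False using neq by blast
    qed
    then obtain h where h: "h < n" "u $ h \<noteq> 0" by blast
    define D where "D = 1\<^sub>m n - P * P'"
    have D: "D \<in> carrier_mat n n" using mult_carrier_mat[OF P P'] by (simp add: D_def minus_carrier_mat)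
    have "P * P' * P = P" using P P' inv by simp
    then have DP: "D * P = 0\<^sub>m n m"
      using minus_mult_distrib_mat[of "1\<^sub>m n" n n "P * P'" P m] P P'
      by (simp add: D_def)
    have "P * P' *\<^sub>v u = 0\<^sub>v n"
      using P P' uc P'u by (simp, intro eq_vecI) auto
    then have Du: "D *\<^sub>v u = u"
      using minus_mult_distrib_mat_vec[of "1\<^sub>m n" n n "P * P'" u] P P' uc
      by (simp add: D_def)
    \<comment> \<open>The new row is the \<open>h\<close>-th row of the complementary projection, scaled to take the value 1
      at \<open>u\<close>; it vanishes on the old columns because \<open>D * P = 0\<close>.\<close>
    define Q where "Q = mat n (Suc m) (\<lambda>(i, j). if j < m then P $$ (i, j) else u $ i)"
    define Q' where "Q' = mat (Suc m) n (\<lambda>(i, j). if i < m then P' $$ (i, j) else D $$ (h, j) / u $ h)"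
    have colQ: "col Q j = (if j < m then col P j else u)" if "j < Suc m" for j
      using that P uc by (intro eq_vecI) (auto simp: Q_def)
    have rowQ': "row Q' i = (if i < m then row P' i else (1 / u $ h) \<cdot>\<^sub>v row D h)" if "i < Suc m" for i
      using that P' D h by (intro eq_vecI) (auto simp: Q'_def)
    have "Q' * Q = 1\<^sub>m (Suc m)"
    proof (rule eq_matI)
      fix i j assume "i < dim_row (1\<^sub>m (Suc m) :: complex mat)" "j < dim_col (1\<^sub>m (Suc m) :: complex mat)"
      then have ij: "i < Suc m" "j < Suc m" by auto
      have e: "(Q' * Q) $$ (i, j) = row Q' i \<bullet> col Q j"
        using ij by (simp add: Q_def Q'_def)
      have a: "row P' i \<bullet> col P j = 1\<^sub>m m $$ (i, j)" if "i < m" "j < m"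
        using arg_cong[OF inv, of "\<lambda>M. M $$ (i, j)"] that P P' by simp
      have b: "row P' i \<bullet> u = 0" if "i < m"
        using arg_cong[OF P'u, of "\<lambda>x. x $ i"] that P' by simp
      have c: "row D h \<bullet> col P j = 0" if "j < m"
        using arg_cong[OF DP, of "\<lambda>M. M $$ (h, j)"] that P D h by simp
      have d: "row D h \<bullet> u = u $ h"
        using arg_cong[OF Du, of "\<lambda>x. x $ h"] D h by simp
      show "(Q' * Q) $$ (i, j) = 1\<^sub>m (Suc m) $$ (i, j)"
        unfolding e rowQ'[OF ij(1)] colQ[OF ij(2)]
        using ij a b c d h P D uc by (auto simp: less_Suc_eq)
    qed (auto simp: Q_def Q'_def)
    moreover have "Q *\<^sub>v v \<in> W" if v: "v \<in> carrier_vec (Suc m)" for v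
    proof -
      define v0 where "v0 = vec m (\<lambda>i. v $ i)"
      have "Q *\<^sub>v v = P *\<^sub>v v0 + (v $ m) \<cdot>\<^sub>v u"
        using v P uc by (intro eq_vecI) (auto simp: Q_def v0_def scalar_prod_def mult.commute)
      moreover have "P *\<^sub>v v0 \<in> W" by (rule PW) (simp add: v0_def)
      ultimately show ?thesis using add smult uW by simp
    qed
    ultimately have "F (Suc m) Q Q'"
      by (simp add: F_def Q_def Q'_def)
    then show False using max[of "Suc m" Q Q'] by simp
  qed
  then show ?thesis using that P P' inv PW by blast
qed

text \<open>
  Frame the range of \<open>D\<close>, which is its space of fixed vectors, by \<open>Q\<close> and \<open>Q\<^sub>0\<close>. The projection
  \<open>Q * Q\<^sub>0\<close> has the same range as \<open>D\<close> but possibly another kernel; replacing \<open>Q\<^sub>0\<close> by \<open>Q\<^sub>0 * D\<close>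
  gives it the kernel of \<open>D\<close>.
\<close>

lemma idempotent_mat_factor:
  fixes D :: "complex mat"
  assumes D: "D \<in> carrier_mat n n" and idem: "D * D = D"
  obtains r Q Q' where "Q \<in> carrier_mat n r" and "Q' \<in> carrier_mat r n"
    and "Q' * Q = 1\<^sub>m r" and "Q * Q' = D"
proof -
  define W where "W = {v \<in> carrier_vec n. D *\<^sub>v v = v}"
  obtain r Q Q0 where Q: "Q \<in> carrier_mat n r" and Q0: "Q0 \<in> carrier_mat r n"
    and inv: "Q0 * Q = 1\<^sub>m r"
    and QW: "\<And>v. v \<in> carrier_vec r \<Longrightarrow> Q *\<^sub>v v \<in> W"
    and fixed: "\<And>w. w \<in> W \<Longrightarrow> Q *\<^sub>v (Q0 *\<^sub>v w) = w"
  proof (rule subspace_frame[of W n])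
    show "W \<subseteq> carrier_vec n" by (auto simp: W_def)
    show "0\<^sub>v n \<in> W" using D by (auto simp: W_def)
    show "v + w \<in> W" if "v \<in> W" "w \<in> W" for v w
      using that mult_add_distrib_mat_vec[OF D] by (auto simp: W_def)
    show "c \<cdot>\<^sub>v v \<in> W" if "v \<in> W" for c v
      using that mult_mat_vec[OF D] by (auto simp: W_def)
  qed blast
  have DQ: "D * Q = Q"
    using D Q QW by (intro mat_eq_if_mult_vec_eq[of _ n r]) (auto simp: W_def)
  have "Q * (Q0 * D) = D"
  proof (rule mat_eq_if_mult_vec_eq[of _ n n])
    fix v :: "complex vec" assume v: "v \<in> carrier_vec n"
    have "D *\<^sub>v (D *\<^sub>v v) = D *\<^sub>v v"
      using assoc_mult_mat_vec[OF D D v] idem by simp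
    then have "D *\<^sub>v v \<in> W" using D v by (simp add: W_def)
    then show "(Q * (Q0 * D)) *\<^sub>v v = D *\<^sub>v v"
      using fixed assoc_mult_mat_vec[OF Q mult_carrier_mat[OF Q0 D] v] assoc_mult_mat_vec[OF Q0 D v]
      by simp
  qed (use Q Q0 D in auto)
  moreover have "(Q0 * D) * Q = 1\<^sub>m r"
    using Q0 D Q DQ inv by simp
  ultimately show ?thesis
    using that[of Q r "Q0 * D"] Q Q0 D by auto
qed

section \<open>Decomposition of characters into irreducible characters\<close>

context complex_algebra
begin

text \<open>
  With \<open>Q\<close> and \<open>Q'\<close> as inclusion and projection, this covers both a subrepresentation and the
  quotient by one: in either case the middle factor \<open>Q * Q'\<close> can be dropped from products.
\<close>

lemma compression_representation:
  assumes rep: "representation_of_degree n R"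
    and Q: "Q \<in> carrier_mat n r" and Q': "Q' \<in> carrier_mat r n" and inv: "Q' * Q = 1\<^sub>m r"
    and mult: "\<And>x y. Q' * (R x * (Q * (Q' * (R y * Q)))) = Q' * (R x * (R y * Q))"
  shows "representation_of_degree r (\<lambda>x. Q' * (R x * Q))"
  unfolding representation_of_degree_def
proof (intro conjI allI)
  have R: "R x \<in> carrier_mat n n" for x
    using rep by (simp add: representation_of_degree_def)
  have RQ: "R x * Q \<in> carrier_mat n r" for x
    using R[of x] Q by simp
  show "Q' * (R x * Q) \<in> carrier_mat r r" for x
    using Q' RQ by simp
  show "Q' * (R (x + y) * Q) = Q' * (R x * Q) + Q' * (R y * Q)" for x y
    using rep add_mult_distrib_mat[OF R[of x] R[of y] Q] mult_add_distrib_mat[OF Q' RQ[of x] RQ[of y]]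
    by (simp add: representation_of_degree_def)
  show "Q' * (R (c *\<^sub>A x) * Q) = c \<cdot>\<^sub>m (Q' * (R x * Q))" for c x
    using rep mult_smult_assoc_mat[OF R[of x] Q, of c] mult_smult_distrib[OF Q' RQ[of x], of c]
    by (simp add: representation_of_degree_def)
  show "Q' * (R (x * y) * Q) = Q' * (R x * Q) * (Q' * (R y * Q))" for x y
  proof -
    have "Q' * (R x * Q) * (Q' * (R y * Q)) = Q' * (R x * Q * (Q' * (R y * Q)))"
      using assoc_mult_mat[OF Q' RQ[of x] mult_carrier_mat[OF Q' RQ[of y]]] .
    also have "R x * Q * (Q' * (R y * Q)) = R x * (Q * (Q' * (R y * Q)))"
      using assoc_mult_mat[OF R[of x] Q mult_carrier_mat[OF Q' RQ[of y]]] .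
    also have "Q' * \<dots> = Q' * (R (x * y) * Q)"
      using mult[of x y] rep assoc_mult_mat[OF R[of x] R[of y] Q]
      by (simp add: representation_of_degree_def)
    finally show ?thesis ..
  qed
  show "Q' * (R 1 * Q) = 1\<^sub>m r"
    using rep Q inv by (simp add: representation_of_degree_def)
qed

text \<open>
  In a basis adapted to \<open>W\<close> the matrices \<open>R x\<close> are block triangular. The diagonal blocks, which
  are \<open>R1\<close> on \<open>W\<close> and \<open>R2\<close> on the quotient by \<open>W\<close>, are compressions of \<open>R\<close>: the idempotents
  \<open>E\<close>, a projection onto \<open>W\<close>, and \<open>D = 1 - E\<close> factor as \<open>P * P'\<close> and \<open>Q * Q'\<close>, and invariance
  of \<open>W\<close> amounts to \<open>Q' * (R x * P) = 0\<close>.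
\<close>

lemma trace_splits_along_invariant_subspace:
  assumes rep: "representation_of_degree n R" and W: "invariant_subspace n R W"
    and W0: "W \<noteq> {0\<^sub>v n}" and Wn: "W \<noteq> carrier_vec n"
  obtains m r R1 R2 where "m < n" and "r < n"
    and "representation_of_degree m R1" and "representation_of_degree r R2"
    and "(\<lambda>x. mat_trace (R x)) = (\<lambda>x. mat_trace (R1 x) + mat_trace (R2 x))"
proof -
  have R: "R x \<in> carrier_mat n n" for x
    using rep by (simp add: representation_of_degree_def)
  have sub: "W \<subseteq> carrier_vec n" and zero: "0\<^sub>v n \<in> W"
    using W by (auto simp: invariant_subspace_def)
  obtain m P P' where P: "P \<in> carrier_mat n m" and P': "P' \<in> carrier_mat m n"
    and inv: "P' * P = 1\<^sub>m m"
    and PW: "\<And>v. v \<in> carrier_vec m \<Longrightarrow> P *\<^sub>v v \<in> W"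
    and fixed: "\<And>w. w \<in> W \<Longrightarrow> P *\<^sub>v (P' *\<^sub>v w) = w"
    using W by (rule_tac subspace_frame[of W n]) (auto simp: invariant_subspace_def)
  define E where "E = P * P'"
  define D where "D = 1\<^sub>m n - E"
  have E: "E \<in> carrier_mat n n" and D: "D \<in> carrier_mat n n"
    using P P' by (auto simp: E_def D_def)
  have EP: "E * P = P"
    using assoc_mult_mat[OF P P' P] inv P by (simp add: E_def)
  have DP: "D * P = 0\<^sub>m n m"
    using minus_mult_distrib_mat[OF one_carrier_mat E P] EP P by (simp add: D_def)
  have "D * E = 0\<^sub>m n n"
    using assoc_mult_mat[OF D P P'] DP P' by (simp add: E_def)
  have "D * D = D"
  proof -
    have "D * D = D * 1\<^sub>m n - D * E"
      using mult_minus_distrib_mat[OF D one_carrier_mat E] by (simp add: D_def)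
    then show ?thesis using D \<open>D * E = 0\<^sub>m n n\<close> by (simp, intro eq_matI) auto
  qed
  then obtain r Q Q' where Q: "Q \<in> carrier_mat n r" and Q': "Q' \<in> carrier_mat r n"
    and inv': "Q' * Q = 1\<^sub>m r" and QQ': "Q * Q' = D"
    using idempotent_mat_factor[OF D] by blast
  have Q'D: "Q' * D = Q'"
    using assoc_mult_mat[OF Q' Q Q'] inv' Q' by (simp add: QQ')
  have Q'P: "Q' * P = 0\<^sub>m r m"
    using assoc_mult_mat[OF Q' D P] DP Q' by (simp add: Q'D)
  have ED: "E + D = 1\<^sub>m n"
    using E by (intro eq_matI) (auto simp: D_def)
  have RP: "P * (P' * (R x * P)) = R x * P" for x
  proof (rule mat_eq_if_mult_vec_eq[of _ n m])
    fix v :: "complex vec" assume v: "v \<in> carrier_vec m"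
    have "R x *\<^sub>v (P *\<^sub>v v) \<in> W"
      using PW[OF v] W by (auto simp: invariant_subspace_def)
    moreover have "(R x * P) *\<^sub>v v = R x *\<^sub>v (P *\<^sub>v v)"
      using assoc_mult_mat_vec[OF R P v] .
    moreover have "(P * (P' * (R x * P))) *\<^sub>v v = P *\<^sub>v (P' *\<^sub>v ((R x * P) *\<^sub>v v))"
      using assoc_mult_mat_vec[OF P mult_carrier_mat[OF P' mult_carrier_mat[OF R[of x] P]] v]
        assoc_mult_mat_vec[OF P' mult_carrier_mat[OF R[of x] P] v] by simp
    ultimately show "(P * (P' * (R x * P))) *\<^sub>v v = (R x * P) *\<^sub>v v"
      using fixed by simp
  qed (use P P' R[of x] in auto)
  have Q'RP: "Q' * (R x * P) = 0\<^sub>m r m" for x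
  proof -
    have M: "P' * (R x * P) \<in> carrier_mat m m" using P P' R[of x] by simp
    have "Q' * (R x * P) = Q' * P * (P' * (R x * P))"
      using assoc_mult_mat[OF Q' P M] RP[of x] by simp
    then show ?thesis using left_mult_zero_mat[OF M] by (simp add: Q'P)
  qed
  define R1 where "R1 = (\<lambda>x. P' * (R x * P))"
  define R2 where "R2 = (\<lambda>x. Q' * (R x * Q))"
  have rep1: "representation_of_degree m R1"
    unfolding R1_def by (rule compression_representation[OF rep P P' inv]) (simp add: RP)
  have rep2: "representation_of_degree r R2"
    unfolding R2_def
  proof (rule compression_representation[OF rep Q Q' inv'])
    fix x y
    have RyQ: "R y * Q \<in> carrier_mat n r" using R[of y] Q by simp
    have P'M: "P' * (R y * Q) \<in> carrier_mat m r" using P' RyQ by simp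
    have RxP: "R x * P \<in> carrier_mat n m" using R[of x] P by simp
    have "Q' * (R x * (P * (P' * (R y * Q)))) = Q' * (R x * P) * (P' * (R y * Q))"
      using assoc_mult_mat[OF R[of x] P P'M] assoc_mult_mat[OF Q' RxP P'M] by simp
    then have killed: "Q' * (R x * (E * (R y * Q))) = 0\<^sub>m r r"
      using Q'RP[of x] left_mult_zero_mat[OF P'M] assoc_mult_mat[OF P P' RyQ] by (simp add: E_def)
    have "R y * Q = E * (R y * Q) + Q * (Q' * (R y * Q))"
      using add_mult_distrib_mat[OF E D RyQ] ED left_mult_one_mat[OF RyQ] assoc_mult_mat[OF Q Q' RyQ] QQ'
      by simp
    then have "Q' * (R x * (R y * Q)) = Q' * (R x * (E * (R y * Q) + Q * (Q' * (R y * Q))))"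
      by simp
    also have "\<dots> = Q' * (R x * (E * (R y * Q))) + Q' * (R x * (Q * (Q' * (R y * Q))))"
    proof -
      have a: "E * (R y * Q) \<in> carrier_mat n r" using E RyQ by simp
      have b: "Q * (Q' * (R y * Q)) \<in> carrier_mat n r" using Q Q' RyQ by simp
      show ?thesis
        using mult_add_distrib_mat[OF R[of x] a b]
          mult_add_distrib_mat[OF Q' mult_carrier_mat[OF R[of x] a] mult_carrier_mat[OF R[of x] b]]
        by simp
    qed
    also have "\<dots> = Q' * (R x * (Q * (Q' * (R y * Q))))"
    proof -
      have "Q' * (R x * (Q * (Q' * (R y * Q)))) \<in> carrier_mat r r"
        using Q Q' RyQ R[of x] by simp
      then show ?thesis unfolding killed by simp
    qed
    finally show "Q' * (R x * (Q * (Q' * (R y * Q)))) = Q' * (R x * (R y * Q))" ..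
  qed
  have trace: "mat_trace (R x) = mat_trace (R1 x) + mat_trace (R2 x)" for x
  proof -
    have "R x = E * R x + D * R x"
      using add_mult_distrib_mat[OF E D R[of x]] ED R[of x] by simp
    then have "mat_trace (R x) = mat_trace (E * R x) + mat_trace (D * R x)"
      using mat_trace_add[of "E * R x" n "D * R x"] E D R[of x] by simp
    also have "mat_trace (E * R x) = mat_trace (P * (P' * R x))"
      using assoc_mult_mat[OF P P' R[of x]] by (simp add: E_def)
    also have "\<dots> = mat_trace (R1 x)"
      using mat_trace_mult_commute[OF P mult_carrier_mat[OF P' R[of x]]]
        assoc_mult_mat[OF P' R[of x] P] by (simp add: R1_def)
    also have "mat_trace (D * R x) = mat_trace (Q * (Q' * R x))"
      using assoc_mult_mat[OF Q Q' R[of x]] by (simp add: QQ')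
    also have "\<dots> = mat_trace (R2 x)"
      using mat_trace_mult_commute[OF Q mult_carrier_mat[OF Q' R[of x]]]
        assoc_mult_mat[OF Q' R[of x] Q] by (simp add: R2_def)
    finally show ?thesis .
  qed
  \<comment> \<open>The dimensions are the traces of the identity, so they add up as well.\<close>
  have dims: "n = m + r"
  proof -
    have "complex_of_nat n = of_nat m + of_nat r"
      using trace[of 1] rep rep1 rep2 mat_trace_one by (simp add: representation_of_degree_def)
    then show ?thesis by (metis of_nat_add of_nat_eq_iff)
  qed
  have "m \<noteq> 0"
  proof
    assume "m = 0"
    have "P *\<^sub>v (P' *\<^sub>v w) = 0\<^sub>v n" for w
      using P P' by (intro eq_vecI) (auto simp: scalar_prod_def \<open>m = 0\<close>)
    then have "w = 0\<^sub>v n" if "w \<in> W" for w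
      using fixed[OF that] by simp
    then show False using W0 zero by blast
  qed
  moreover have "r \<noteq> 0"
  proof
    assume "r = 0"
    then have "D = 0\<^sub>m n n"
      using QQ' Q Q' by (intro eq_matI) (auto simp: scalar_prod_def)
    then have "E = 1\<^sub>m n" using ED E by simp
    have "w \<in> W" if w: "w \<in> carrier_vec n" for w
    proof -
      have "P *\<^sub>v (P' *\<^sub>v w) = w"
        using assoc_mult_mat_vec[OF P P' w] \<open>E = 1\<^sub>m n\<close> w by (simp add: E_def)
      then show ?thesis using PW[of "P' *\<^sub>v w"] P' w by simp
    qed
    then show False using Wn sub by blast
  qed
  ultimately show ?thesis
    using that[OF _ _ rep1 rep2] trace dims by simp
qed

lemma trace_is_sum_of_irreducible_characters:
  assumes "representation_of_degree n R"
  shows "\<exists>M. (\<forall>\<phi>\<in>#M. irreducible_character \<phi>) \<and> (\<lambda>x. mat_trace (R x)) = (\<lambda>x. \<Sum>\<phi>\<in>#M. \<phi> x)"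
  using assms
proof (induction n arbitrary: R rule: less_induct)
  case (less n)
  note rep = less.prems
  consider "n = 0" | "irreducible_representation n R"
    | W where "invariant_subspace n R W" "W \<noteq> {0\<^sub>v n}" "W \<noteq> carrier_vec n"
    using rep by (auto simp: irreducible_representation_def)
  then show ?case
  proof cases
    case 1
    then have "dim_row (R x) = 0" for x
      using rep by (metis carrier_matD(1) representation_of_degree_def)
    then have "mat_trace (R x) = 0" for x
      by (simp add: mat_trace_def)
    then show ?thesis by (intro exI[of _ "{#}"]) simp
  next
    case 2
    then show ?thesis
      by (intro exI[of _ "{#\<lambda>x. mat_trace (R x)#}"]) (auto simp: irreducible_character_def)
  next
    case 3
    obtain m r R1 R2 where m: "m < n" and r: "r < n"
      and R1: "representation_of_degree m R1" and R2: "representation_of_degree r R2"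
      and tr: "(\<lambda>x. mat_trace (R x)) = (\<lambda>x. mat_trace (R1 x) + mat_trace (R2 x))"
      using trace_splits_along_invariant_subspace[OF rep 3] .
    obtain M1 where M1: "\<forall>\<phi>\<in>#M1. irreducible_character \<phi>"
        "(\<lambda>x. mat_trace (R1 x)) = (\<lambda>x. \<Sum>\<phi>\<in>#M1. \<phi> x)"
      using less.IH[OF m R1] by blast
    obtain M2 where M2: "\<forall>\<phi>\<in>#M2. irreducible_character \<phi>"
        "(\<lambda>x. mat_trace (R2 x)) = (\<lambda>x. \<Sum>\<phi>\<in>#M2. \<phi> x)"
      using less.IH[OF r R2] by blast
    have "(\<lambda>x. mat_trace (R x)) = (\<lambda>x. \<Sum>\<phi>\<in>#(M1 + M2). \<phi> x)"
      unfolding tr using M1(2) M2(2) by (simp add: fun_eq_iff)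
    then show ?thesis
      using M1(1) M2(1) by (intro exI[of _ "M1 + M2"]) auto
  qed
qed

end

section \<open>Separating an irreducible representation from the others\<close>

context complex_algebra
begin

lemma representation_sum_mult_vec:
  assumes rep: "representation_of_degree n R" and "finite A" and w: "w \<in> carrier_vec n" and i: "i < n"
  shows "(R (\<Sum>j\<in>A. f j) *\<^sub>v w) $ i = (\<Sum>j\<in>A. (R (f j) *\<^sub>v w) $ i)"
  using \<open>finite A\<close>
proof (induction A rule: finite_induct)
  have R: "R x \<in> carrier_mat n n" and add: "R (x + y) = R x + R y" for x y
    using rep by (auto simp: representation_of_degree_def)
  case empty
  have "(R 0 *\<^sub>v w) $ i = (R 0 *\<^sub>v w) $ i + (R 0 *\<^sub>v w) $ i"
    using add[of 0 0] add_mult_distrib_mat_vec[OF R R w, of 0 0] R[of 0] i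
    by (metis add.right_neutral carrier_matD(1) dim_mult_mat_vec index_add_vec(1))
  then show ?case by simp
next
  have R: "R x \<in> carrier_mat n n" and add: "R (x + y) = R x + R y" for x y
    using rep by (auto simp: representation_of_degree_def)
  case (insert a A)
  have "(R (f a + (\<Sum>j\<in>A. f j)) *\<^sub>v w) $ i = (R (f a) *\<^sub>v w) $ i + (R (\<Sum>j\<in>A. f j) *\<^sub>v w) $ i"
    unfolding add using add_mult_distrib_mat_vec[OF R R w] R i
    by (metis carrier_matD(1) dim_mult_mat_vec index_add_vec(1))
  then show ?case using insert by simp
qed

text \<open>
  This is Schur's lemma: kernel and range of \<open>T\<close> are invariant, so \<open>T\<close> is bijective. With a
  two-sided inverse \<open>G\<close> of the a priori rectangular matrix \<open>T\<close>, the cyclic property of the trace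
  gives the equality of the two characters.
\<close>

lemma intertwined_irreducibles_trace_eq:
  assumes irrR: "irreducible_representation n R" and irrS: "irreducible_representation m S"
    and T: "T \<in> carrier_mat n m" and nonzero: "T \<noteq> 0\<^sub>m n m"
    and intertwine: "\<And>y. T * S y = R y * T"
  shows "mat_trace (S y) = mat_trace (R y)"
proof -
  have R: "R x \<in> carrier_mat n n" and S: "S x \<in> carrier_mat m m" for x
    using irrR irrS by (auto simp: irreducible_representation_def representation_of_degree_def)
  have TS: "T *\<^sub>v (S x *\<^sub>v u) = R x *\<^sub>v (T *\<^sub>v u)" if "u \<in> carrier_vec m" for x u
    using assoc_mult_mat_vec[OF T S that] assoc_mult_mat_vec[OF R T that] intertwine by metis
  obtain u0 where u0: "u0 \<in> carrier_vec m" "T *\<^sub>v u0 \<noteq> 0\<^sub>v n"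
    using nonzero_mat_obtain_vec[OF T nonzero] .
  let ?ker = "{u \<in> carrier_vec m. T *\<^sub>v u = 0\<^sub>v n}"
  have "invariant_subspace m S ?ker"
    unfolding invariant_subspace_def
    using mult_mat_vec_carrier[OF S] TS mult_mat_zero_vec[OF T] mult_mat_zero_vec[OF R]
      mult_add_distrib_mat_vec[OF T] mult_mat_vec[OF T]
    by auto
  moreover have "?ker \<noteq> carrier_vec m" using u0 by blast
  ultimately have ker: "?ker = {0\<^sub>v m}"
    using irrS by (auto simp: irreducible_representation_def)
  let ?ran = "(\<lambda>u. T *\<^sub>v u) ` carrier_vec m"
  have "invariant_subspace n R ?ran"
    unfolding invariant_subspace_def
  proof (intro conjI ballI allI)
    show "?ran \<subseteq> carrier_vec n" using T by auto
    show "0\<^sub>v n \<in> ?ran" using T mult_mat_zero_vec[OF T] by (intro image_eqI[of _ _ "0\<^sub>v m"]) auto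
    show "v + w \<in> ?ran" if vw: "v \<in> ?ran" "w \<in> ?ran" for v w
    proof -
      obtain a b where "a \<in> carrier_vec m" "b \<in> carrier_vec m" "v = T *\<^sub>v a" "w = T *\<^sub>v b"
        using vw by blast
      then show ?thesis
        using mult_add_distrib_mat_vec[OF T, of a b] by (intro image_eqI[of _ _ "a + b"]) auto
    qed
    show "c \<cdot>\<^sub>v v \<in> ?ran" if v: "v \<in> ?ran" for c v
    proof -
      obtain a where "a \<in> carrier_vec m" "v = T *\<^sub>v a"
        using v by blast
      then show ?thesis
        using mult_mat_vec[OF T, of a c] by (intro image_eqI[of _ _ "c \<cdot>\<^sub>v a"]) auto
    qed
    show "R x *\<^sub>v v \<in> ?ran" if v: "v \<in> ?ran" for x v
    proof -
      obtain a where "a \<in> carrier_vec m" "v = T *\<^sub>v a"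
        using v by blast
      then show ?thesis
        using TS[of a x] mult_mat_vec_carrier[OF S, of a x] by (intro image_eqI[of _ _ "S x *\<^sub>v a"]) auto
    qed
  qed
  moreover have "?ran \<noteq> {0\<^sub>v n}" using u0 by blast
  ultimately have ran: "?ran = carrier_vec n"
    using irrR by (auto simp: irreducible_representation_def)
  have "\<exists>g. g \<in> carrier_vec m \<and> T *\<^sub>v g = unit_vec n j" for j
  proof -
    have "unit_vec n j \<in> ?ran" unfolding ran by simp
    then obtain a where "a \<in> carrier_vec m" "unit_vec n j = T *\<^sub>v a" by blast
    then show ?thesis by metis
  qed
  then obtain g where g: "\<And>j. g j \<in> carrier_vec m" "\<And>j. T *\<^sub>v g j = unit_vec n j"
    by metis
  define G where "G = mat m n (\<lambda>(i, j). g j $ i)"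
  have G: "G \<in> carrier_mat m n" by (simp add: G_def)
  have TG: "T * G = 1\<^sub>m n"
  proof (rule eq_matI)
    fix i j assume "i < dim_row (1\<^sub>m n :: complex mat)" "j < dim_col (1\<^sub>m n :: complex mat)"
    then have ij: "i < n" "j < n" by auto
    have "col G j = g j" using ij g(1)[of j] by (intro eq_vecI) (auto simp: G_def)
    then have "(T * G) $$ (i, j) = (T *\<^sub>v g j) $ i" using ij T G by simp
    also have "\<dots> = 1\<^sub>m n $$ (i, j)" unfolding g(2) using ij by simp
    finally show "(T * G) $$ (i, j) = 1\<^sub>m n $$ (i, j)" .
  qed (use T G in auto)
  have GT: "G * T = 1\<^sub>m m"
  proof (rule mat_eq_if_mult_vec_eq[of _ m m])
    fix u :: "complex vec" assume u: "u \<in> carrier_vec m"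
    have Tu: "T *\<^sub>v u \<in> carrier_vec n" and GTu: "G *\<^sub>v (T *\<^sub>v u) \<in> carrier_vec m"
      using T G u by auto
    have "T *\<^sub>v (G *\<^sub>v (T *\<^sub>v u)) = T *\<^sub>v u"
      using assoc_mult_mat_vec[OF T G Tu] TG Tu by simp
    then have "T *\<^sub>v (G *\<^sub>v (T *\<^sub>v u) - u) = 0\<^sub>v n"
      using mult_minus_distrib_mat_vec[OF T GTu u] Tu by simp
    then have "G *\<^sub>v (T *\<^sub>v u) - u \<in> ?ker" using GTu u by simp
    then have z: "G *\<^sub>v (T *\<^sub>v u) - u = 0\<^sub>v m" unfolding ker by simp
    have "a = u" if "a \<in> carrier_vec m" "a - u = 0\<^sub>v m" for a
    proof (rule eq_vecI)
      fix i assume "i < dim_vec u"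
      then have "(a - u) $ i = 0" using that u by simp
      then show "a $ i = u $ i" using \<open>i < dim_vec u\<close> that(1) u by simp
    qed (use that u in auto)
    then have "G *\<^sub>v (T *\<^sub>v u) = u" using z GTu by blast
    then show "(G * T) *\<^sub>v u = 1\<^sub>m m *\<^sub>v u"
      using assoc_mult_mat_vec[OF G T u] u by simp
  qed (use G T in auto)
  have TSy: "T * S y \<in> carrier_mat n m" using T S[of y] by simp
  have "mat_trace (S y) = mat_trace (G * (T * S y))"
    using assoc_mult_mat[OF G T S] GT S[of y] by (metis left_mult_one_mat)
  also have "\<dots> = mat_trace (R y * T * G)"
    using mat_trace_mult_commute[OF G TSy] intertwine by simp
  also have "\<dots> = mat_trace (R y)"
    using assoc_mult_mat[OF R T G] TG R[of y] by simp
  finally show ?thesis .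
qed

end

locale finite_dimensional_complex_algebra =
  complex_algebra scale + finite_dimensional_vector_space scale Basis
  for scale :: "complex \<Rightarrow> 'a::ring_1 \<Rightarrow> 'a" (infixr "*\<^sub>A" 75) and Basis :: "'a set"
begin

text \<open>
  Let \<open>L\<close> be a left ideal of least dimension on which \<open>R\<close> does not vanish, and \<open>x\<^sub>0 \<in> L\<close> with
  \<open>R x\<^sub>0 \<noteq> 0\<close>. Suppose that some irreducible \<open>S\<close> has \<open>S x\<^sub>0 v \<noteq> 0\<close>. The elements of \<open>L\<close> with
  \<open>S x v = 0\<close> form a left ideal properly contained in \<open>L\<close>, so \<open>R\<close> vanishes on them. Hence, for
  every vector \<open>w\<close>, the assignment \<open>S x v \<mapsto> R x w\<close> for \<open>x \<in> L\<close> is well defined. Its domain is the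
  whole space of \<open>S\<close> by irreducibility, it commutes with the two actions, and it is nonzero if
  \<open>R x\<^sub>0 w \<noteq> 0\<close>. By Schur's lemma \<open>S\<close> and \<open>R\<close> have the same character. Thus \<open>x\<^sub>0\<close> itself
  separates \<open>R\<close> from all other irreducible representations at once.
\<close>

lemma irreducible_separating_element:
  assumes irrR: "irreducible_representation n R"
  obtains x where "R x \<noteq> 0\<^sub>m n n"
    and "\<And>m S. irreducible_representation m S \<Longrightarrow>
           (\<lambda>y. mat_trace (S y)) \<noteq> (\<lambda>y. mat_trace (R y)) \<Longrightarrow> S x = 0\<^sub>m m m"
proof -
  have repR: "representation_of_degree n R" and n: "n > 0"
    using irrR by (auto simp: irreducible_representation_def)
  have R: "R x \<in> carrier_mat n n" for x
    using repR by (auto simp: representation_of_degree_def)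
  define left_ideal where "left_ideal L \<longleftrightarrow> subspace L \<and> (\<forall>a. \<forall>x\<in>L. a * x \<in> L)" for L
  define good where "good L \<longleftrightarrow> left_ideal L \<and> (\<exists>x\<in>L. R x \<noteq> 0\<^sub>m n n)" for L
  have "R 1 \<noteq> 0\<^sub>m n n"
  proof
    assume "R 1 = 0\<^sub>m n n"
    then have "(1\<^sub>m n :: complex mat) $$ (0, 0) = 0\<^sub>m n n $$ (0, 0)"
      using repR by (simp add: representation_of_degree_def)
    then show False using n by simp
  qed
  then have "good UNIV"
    by (auto simp: good_def left_ideal_def subspace_UNIV)
  then obtain L where L: "good L" and min: "\<And>K. good K \<Longrightarrow> dim L \<le> dim K"
    using ex_has_least_nat[of good UNIV dim] by blast
  have subL: "subspace L" and idL: "\<And>a x. x \<in> L \<Longrightarrow> a * x \<in> L"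
    using L by (auto simp: good_def left_ideal_def)
  obtain x0 where x0: "x0 \<in> L" "R x0 \<noteq> 0\<^sub>m n n"
    using L by (auto simp: good_def)
  have "S x0 = 0\<^sub>m m m" if irrS: "irreducible_representation m S"
    and ne: "(\<lambda>y. mat_trace (S y)) \<noteq> (\<lambda>y. mat_trace (R y))" for m S
  proof (rule ccontr)
    assume Sx0: "S x0 \<noteq> 0\<^sub>m m m"
    have repS: "representation_of_degree m S"
      using irrS by (auto simp: irreducible_representation_def)
    have S: "S x \<in> carrier_mat m m" for x
      using repS by (auto simp: representation_of_degree_def)
    obtain v where v: "v \<in> carrier_vec m" "S x0 *\<^sub>v v \<noteq> 0\<^sub>v m"
      using nonzero_mat_obtain_vec[OF S Sx0] .
    obtain w where w: "w \<in> carrier_vec n" "R x0 *\<^sub>v w \<noteq> 0\<^sub>v n"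
      using nonzero_mat_obtain_vec[OF R x0(2)] .
    have Smult: "S (x * y) *\<^sub>v v = S x *\<^sub>v (S y *\<^sub>v v)" for x y
      using repS assoc_mult_mat_vec[OF S S v(1)] by (simp add: representation_of_degree_def)
    have Rmult: "R (x * y) *\<^sub>v w = R x *\<^sub>v (R y *\<^sub>v w)" for x y
      using repR assoc_mult_mat_vec[OF R R w(1)] by (simp add: representation_of_degree_def)
    have Sadd: "S (x + y) *\<^sub>v v = S x *\<^sub>v v + S y *\<^sub>v v" for x y
      using repS add_mult_distrib_mat_vec[OF S S v(1)] by (simp add: representation_of_degree_def)
    have smult_vec: "(c \<cdot>\<^sub>m M) *\<^sub>v u = c \<cdot>\<^sub>v (M *\<^sub>v u)"
      if "M \<in> carrier_mat l l" "u \<in> carrier_vec l" for c :: complex and M u l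
      using that by (intro eq_vecI) auto
    have Sscale: "S (c *\<^sub>A x) *\<^sub>v v = c \<cdot>\<^sub>v (S x *\<^sub>v v)" for c x
      using repS smult_vec[OF S v(1)] by (simp add: representation_of_degree_def)
    have Rscale: "R (c *\<^sub>A x) *\<^sub>v w = c \<cdot>\<^sub>v (R x *\<^sub>v w)" for c x
      using repR smult_vec[OF R w(1)] by (simp add: representation_of_degree_def)
    have S0: "S 0 *\<^sub>v v = 0\<^sub>v m"
      using representation_sum_mult_vec[OF repS finite.emptyI v(1)] S[of 0] by (intro eq_vecI) auto
    have R0: "R 0 *\<^sub>v w = 0\<^sub>v n"
      using representation_sum_mult_vec[OF repR finite.emptyI w(1)] R[of 0] by (intro eq_vecI) auto
    let ?K = "{x \<in> L. S x *\<^sub>v v = 0\<^sub>v m}"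
    have "left_ideal ?K"
      unfolding left_ideal_def
      using subL idL S0 mult_mat_zero_vec[OF S]
      by (auto simp: subspace_def Sadd Sscale Smult)
    moreover have "\<not> good ?K"
    proof
      assume K: "good ?K"
      then have "?K = L"
        using subspace_dim_equal[of ?K L] min[OF K] subL by (auto simp: good_def left_ideal_def)
      then show False using x0 v by blast
    qed
    ultimately have annih: "R x = 0\<^sub>m n n" if "x \<in> L" "S x *\<^sub>v v = 0\<^sub>v m" for x
      using that by (auto simp: good_def)
    let ?W = "(\<lambda>x. S x *\<^sub>v v) ` L"
    have "invariant_subspace m S ?W"
      unfolding invariant_subspace_def
    proof (intro conjI ballI allI)
      show "?W \<subseteq> carrier_vec m" using mult_mat_vec_carrier[OF S v(1)] by auto
      show "0\<^sub>v m \<in> ?W"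
        using S0 subspace_0[OF subL] by (intro image_eqI[of _ _ 0]) auto
      show "a + b \<in> ?W" if ab: "a \<in> ?W" "b \<in> ?W" for a b
      proof -
        obtain x y where "x \<in> L" "y \<in> L" "a = S x *\<^sub>v v" "b = S y *\<^sub>v v"
          using ab by blast
        then show ?thesis
          using Sadd[of x y] subspace_add[OF subL, of x y] by (intro image_eqI[of _ _ "x + y"]) auto
      qed
      show "c \<cdot>\<^sub>v a \<in> ?W" if a: "a \<in> ?W" for c a
      proof -
        obtain x where "x \<in> L" "a = S x *\<^sub>v v"
          using a by blast
        then show ?thesis
          using Sscale[of c x] subspace_scale[OF subL, of x c] by (intro image_eqI[of _ _ "c *\<^sub>A x"]) auto
      qed
      show "S y *\<^sub>v a \<in> ?W" if a: "a \<in> ?W" for y a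
      proof -
        obtain x where "x \<in> L" "a = S x *\<^sub>v v"
          using a by blast
        then show ?thesis
          using Smult[of y x] idL[of x y] by (intro image_eqI[of _ _ "y * x"]) auto
      qed
    qed
    moreover have "?W \<noteq> {0\<^sub>v m}" using v x0 by blast
    ultimately have orbit: "?W = carrier_vec m"
      using irrS by (auto simp: irreducible_representation_def)
    have "\<exists>x\<in>L. S x *\<^sub>v v = unit_vec m j" for j
    proof -
      have "unit_vec m j \<in> ?W" unfolding orbit by simp
      then obtain x where "x \<in> L" "unit_vec m j = S x *\<^sub>v v" by blast
      then show ?thesis by metis
    qed
    then obtain X where X: "\<And>j. X j \<in> L" "\<And>j. S (X j) *\<^sub>v v = unit_vec m j"
      by metis
    \<comment> \<open>The matrix of the map \<open>S x v \<mapsto> R x w\<close> in the standard bases.\<close>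
    define T where "T = mat n m (\<lambda>(i, j). (R (X j) *\<^sub>v w) $ i)"
    have T: "T \<in> carrier_mat n m" by (simp add: T_def)
    have key: "T *\<^sub>v (S x *\<^sub>v v) = R x *\<^sub>v w" if x: "x \<in> L" for x
    proof -
      define u where "u = S x *\<^sub>v v"
      have u: "u \<in> carrier_vec m" unfolding u_def using mult_mat_vec_carrier[OF S v(1)] .
      \<comment> \<open>The element \<open>z = (\<Sum>j<m. u\<^sub>j X\<^sub>j) - x\<close> of \<open>L\<close> satisfies \<open>S z v = 0\<close>, which forces
        \<open>R z = 0\<close>. It is written as a single sum of \<open>m + 1\<close> terms.\<close>
      define f where "f j = (if j < m then (u $ j) *\<^sub>A X j else - x)" for j
      define z where "z = (\<Sum>j<Suc m. f j)"
      have fL: "f j \<in> L" for j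
        using X x subL by (auto simp: f_def subspace_scale subspace_neg)
      have zL: "z \<in> L"
        unfolding z_def using fL subL by (intro subspace_sum) auto
      have neg: "- x = (-1) *\<^sub>A x" by simp
      have "(S z *\<^sub>v v) $ i = 0" if i: "i < m" for i
      proof -
        have "(S z *\<^sub>v v) $ i = (\<Sum>j<Suc m. (S (f j) *\<^sub>v v) $ i)"
          unfolding z_def using representation_sum_mult_vec[OF repS _ v(1) i] by blast
        also have "\<dots> = (\<Sum>j<m. u $ j * unit_vec m j $ i) - u $ i"
          using i S v u unfolding f_def neg
          by (simp add: Sscale X(2) u_def[symmetric] del: index_mult_mat_vec scale_minus_left)
        also have "(\<Sum>j<m. u $ j * unit_vec m j $ i) = (\<Sum>j<m. if i = j then u $ j else 0)"
          using i by (intro sum.cong) auto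
        also have "\<dots> = u $ i" using i by simp
        finally show ?thesis by simp
      qed
      then have "S z *\<^sub>v v = 0\<^sub>v m" using S[of z] by (intro eq_vecI) auto
      then have Rz: "R z = 0\<^sub>m n n" using annih zL by blast
      show ?thesis
      proof (rule eq_vecI)
        fix i assume "i < dim_vec (R x *\<^sub>v w)"
        then have i: "i < n" using R[of x] by simp
        have Rw: "R y *\<^sub>v w \<in> carrier_vec n" for y using R[of y] w by simp
        have "0 = (R z *\<^sub>v w) $ i" using Rz i w by simp
        also have "\<dots> = (\<Sum>j<Suc m. (R (f j) *\<^sub>v w) $ i)"
          unfolding z_def using representation_sum_mult_vec[OF repR _ w(1) i] by blast
        also have "\<dots> = (\<Sum>j<m. u $ j * (R (X j) *\<^sub>v w) $ i) - (R x *\<^sub>v w) $ i"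
          using i Rw unfolding f_def neg
          by (simp add: Rscale carrier_vecD[OF Rw] del: index_mult_mat_vec scale_minus_left dim_mult_mat_vec)
        also have "(\<Sum>j<m. u $ j * (R (X j) *\<^sub>v w) $ i) = (T *\<^sub>v u) $ i"
          using i u by (simp add: T_def scalar_prod_def atLeast0LessThan mult.commute del: index_mult_mat_vec)
            (simp add: scalar_prod_def atLeast0LessThan mult.commute)
        finally show "(T *\<^sub>v (S x *\<^sub>v v)) $ i = (R x *\<^sub>v w) $ i"
          by (simp add: u_def)
      qed (use T R[of x] in simp)
    qed
    have intertwine: "T * S y = R y * T" for y
    proof (rule mat_eq_if_mult_vec_eq[of _ n m])
      fix u :: "complex vec" assume u: "u \<in> carrier_vec m"
      then obtain x where x: "x \<in> L" and ux: "u = S x *\<^sub>v v" using orbit by blast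
      have "(T * S y) *\<^sub>v u = T *\<^sub>v (S (y * x) *\<^sub>v v)"
        using assoc_mult_mat_vec[OF T S u] by (simp add: Smult ux)
      also have "\<dots> = R y *\<^sub>v (T *\<^sub>v u)"
        using key[OF idL[OF x]] key[OF x] by (simp add: Rmult ux)
      also have "\<dots> = (R y * T) *\<^sub>v u"
        using assoc_mult_mat_vec[OF R T u] by simp
      finally show "(T * S y) *\<^sub>v u = (R y * T) *\<^sub>v u" .
    qed (use T R[of y] S[of y] in auto)
    have "T \<noteq> 0\<^sub>m n m"
    proof
      assume "T = 0\<^sub>m n m"
      moreover have "S x0 *\<^sub>v v \<in> carrier_vec m" using mult_mat_vec_carrier[OF S v(1)] .
      ultimately show False using key[OF x0(1)] w(2) zero_mat_mult_vec by metis
    qed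
    then have "mat_trace (S y) = mat_trace (R y)" for y
      using intertwined_irreducibles_trace_eq[OF irrR irrS T _ intertwine] by blast
    then show False using ne by blast
  qed
  then show ?thesis using that x0(2) by blast
qed

end

section \<open>The coordinate at the identity of a table algebra\<close>

text \<open>
  The Lagrange basis polynomial of the point \<open>a\<close> among the nodes \<open>S\<close>.
\<close>

lemma polynomial_indicator_of_point:
  fixes S :: "'b::field set"
  assumes "finite S" and "a \<in> S"
  obtains c where "\<And>z. z \<in> S \<Longrightarrow> (\<Sum>i\<le>card S - 1. c i * z ^ i) = (if z = a then 1 else 0)"
proof -
  define p where "p = (\<Prod>s\<in>S - {a}. [:- s, 1:])"
  have p0: "poly p z = 0 \<longleftrightarrow> z \<in> S - {a}" for z
    using assms(1) by (auto simp: p_def poly_prod)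
  have deg: "degree p = card S - 1"
    using assms by (simp add: p_def degree_prod_eq_sum_degree)
  define c where "c i = coeff p i / poly p a" for i
  have "(\<Sum>i\<le>card S - 1. c i * z ^ i) = (if z = a then 1 else 0)" if "z \<in> S" for z
  proof -
    have "(\<Sum>i\<le>card S - 1. c i * z ^ i) = poly p z / poly p a"
      by (simp add: c_def poly_altdef deg sum_divide_distrib)
    then show ?thesis using p0[of z] p0[of a] that by auto
  qed
  then show ?thesis using that by blast
qed

sublocale table_algebra \<subseteq> finite_dimensional_complex_algebra scale B ..

context table_algebra
begin

lemma deg_one: "deg 1 = 1"
proof -
  have "mat 1 1 (\<lambda>_. linear_extension B (\<lambda>b. complex_of_real (deg b)) 1) = 1\<^sub>m 1"
    using degree_representation by (simp add: representation_of_degree_def)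
  then have "mat 1 1 (\<lambda>_. linear_extension B (\<lambda>b. complex_of_real (deg b)) 1) $$ (0, 0)
      = (1\<^sub>m 1 :: complex mat) $$ (0, 0)"
    by simp
  then show ?thesis
    by (simp add: linear_extension_basis[OF one_in_basis])
qed

lemma char_power_eq:
  "char_power \<chi> j x
     = (\<Sum>b\<in>B. representation B x b * (complex_of_real (deg b) * (\<chi> b / complex_of_real (deg b)) ^ j))"
proof (cases j)
  case 0
  then show ?thesis by (simp add: degree_map_def linear_extension_def)
next
  case (Suc i)
  show ?thesis
    unfolding Suc char_power.simps char_prod_def linear_extension_def
    by (rule sum.cong) (simp_all add: char_power_basis)
qed

lemma coordinate_at_one_mult_star:
  assumes b: "b \<in> B"
  shows "representation B (x * star b) 1 = complex_of_real (deg b) * representation B x b"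
proof -
  have span: "y \<in> span B" for y by (simp add: span_Basis)
  have expand: "(\<Sum>a\<in>B. representation B x a *\<^sub>A a) = x"
    by (rule sum_representation_eq[OF independent_Basis span finite_Basis order_refl])
  have "x * star b = (\<Sum>a\<in>B. representation B x a *\<^sub>A a) * star b"
    by (simp only: expand)
  also have "\<dots> = (\<Sum>a\<in>B. representation B x a *\<^sub>A (a * star b))"
    by (simp only: sum_distrib_right scale_mult_left)
  finally have "representation B (x * star b) 1
      = (\<Sum>a\<in>B. representation B x a * representation B (a * star b) 1)"
    by (simp add: representation_sum[OF independent_Basis] representation_scale[OF independent_Basis] span)
  also have "\<dots> = (\<Sum>a\<in>B. if a = b then complex_of_real (deg b) * representation B x b else 0)"
  proof (rule sum.cong)
    fix a assume a: "a \<in> B"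
    have "star b \<in> B" using b star_basis by blast
    then show "representation B x a * representation B (a * star b) 1
        = (if a = b then complex_of_real (deg b) * representation B x b else 0)"
      using structure_constant_one[OF a, of "star b"] by (simp add: star_star)
  qed simp
  also have "\<dots> = complex_of_real (deg b) * representation B x b"
    using b finite_Basis by simp
  finally show ?thesis .
qed

text \<open>
  Every coordinate of \<open>x\<close> is, up to a positive factor, the coordinate at \<open>1\<close> of a multiple of \<open>x\<close>.
\<close>

lemma coordinate_at_one_nondegenerate:
  assumes "\<And>y. representation B (x * y) 1 = 0"
  shows "x = 0"
proof -
  have span: "x \<in> span B" by (simp add: span_Basis)
  have "representation B x b = 0" if "b \<in> B" for b
    using coordinate_at_one_mult_star[OF that, of x] assms deg_pos[OF that] by simp
  then have "(\<Sum>b\<in>B. representation B x b *\<^sub>A b) = 0" by simp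
  then show ?thesis
    using sum_representation_eq[OF independent_Basis span finite_Basis order_refl] by simp
qed

text \<open>
  Both sides are linear in \<open>x\<close>. On a basis element \<open>b\<close> the right-hand side is \<open>|b|\<close> times a
  polynomial in \<open>\<chi> b / |b|\<close>; the Lagrange polynomial that singles out the value at \<open>1\<close> makes it
  vanish for \<open>b \<noteq> 1\<close>, because \<open>1\<close> is the only basis element in the kernel of \<open>\<chi>\<close>.
\<close>

lemma coordinate_at_one_as_combination_of_powers:
  assumes ker: "char_kernel \<chi> = {1}"
    and k: "card ((\<lambda>b. \<chi> b / complex_of_real (deg b)) ` B) = k"
  obtains c where "\<And>x. representation B x 1 = (\<Sum>i\<le>k - 1. c i * char_power \<chi> i x)"
proof -
  define \<alpha> where "\<alpha> b = \<chi> b / complex_of_real (deg b)" for b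
  have one: "\<alpha> b = \<alpha> 1 \<longleftrightarrow> b = 1" if b: "b \<in> B" for b
  proof -
    have "\<alpha> b = \<alpha> 1 \<longleftrightarrow> b \<in> char_kernel \<chi>"
      using deg_pos[OF b] b by (simp add: \<alpha>_def char_kernel_def deg_one field_simps)
    then show ?thesis by (simp add: ker)
  qed
  obtain c where c: "\<And>z. z \<in> \<alpha> ` B \<Longrightarrow>
      (\<Sum>i\<le>card (\<alpha> ` B) - 1. c i * z ^ i) = (if z = \<alpha> 1 then 1 else 0)"
    using polynomial_indicator_of_point[of "\<alpha> ` B" "\<alpha> 1"] finite_Basis one_in_basis by blast
  have k': "card (\<alpha> ` B) = k" using k by (simp add: \<alpha>_def)
  have "representation B x 1 = (\<Sum>i\<le>k - 1. c i * char_power \<chi> i x)" for x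
  proof -
    have "(\<Sum>i\<le>k - 1. c i * char_power \<chi> i x)
        = (\<Sum>b\<in>B. representation B x b * (complex_of_real (deg b) * (\<Sum>i\<le>k - 1. c i * \<alpha> b ^ i)))"
      unfolding char_power_eq \<alpha>_def[symmetric] sum_distrib_left
      by (subst sum.swap) (simp add: mult_ac)
    also have "\<dots> = (\<Sum>b\<in>B. if b = 1 then representation B x 1 else 0)"
      using c one by (intro sum.cong) (auto simp: k' deg_one)
    also have "\<dots> = representation B x 1"
      using one_in_basis finite_Basis by simp
    finally show ?thesis ..
  qed
  then show ?thesis using that by blast
qed

section \<open>Irreducible characters inside the powers of a character\<close>

lemma irreducible_in_some_power:
  assumes ker: "char_kernel \<chi> = {1}"
    and k: "card ((\<lambda>b. \<chi> b / complex_of_real (deg b)) ` B) = k"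
    and powers: "\<And>j. character (char_power \<chi> j)"
    and irr: "irreducible_character \<psi>"
  shows "\<exists>i\<in>{0..k - 1}. irreducible_component \<psi> (char_power \<chi> i)"
proof (rule ccontr)
  assume "\<not> ?thesis"
  then have not_comp: "\<not> irreducible_component \<psi> (char_power \<chi> i)" if "i \<le> k - 1" for i
    using that by auto
  obtain n R where R: "irreducible_representation n R" and \<psi>: "\<psi> = (\<lambda>x. mat_trace (R x))"
    using irr by (auto simp: irreducible_character_def)
  obtain x where Rx: "R x \<noteq> 0\<^sub>m n n"
    and kill: "\<And>m S. irreducible_representation m S \<Longrightarrow>
           (\<lambda>y. mat_trace (S y)) \<noteq> \<psi> \<Longrightarrow> S x = 0\<^sub>m m m"
    using irreducible_separating_element[OF R] unfolding \<psi> by blast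
  have char0: "\<phi> (x * y) = 0" if irr\<phi>: "irreducible_character \<phi>" and ne: "\<phi> \<noteq> \<psi>" for \<phi> y
  proof -
    obtain m S where S: "irreducible_representation m S" and \<phi>: "\<phi> = (\<lambda>x. mat_trace (S x))"
      using irr\<phi> by (auto simp: irreducible_character_def)
    have "S (x * y) = S x * S y" and Sy: "S y \<in> carrier_mat m m"
      using S by (auto simp: irreducible_representation_def representation_of_degree_def)
    moreover have "S x = 0\<^sub>m m m"
      using kill[OF S] ne by (simp add: \<phi>)
    ultimately have "S (x * y) = 0\<^sub>m m m"
      using left_mult_zero_mat[OF Sy] by simp
    then show ?thesis by (simp add: \<phi> mat_trace_def)
  qed
  have power0: "char_power \<chi> i (x * y) = 0" if i: "i \<le> k - 1" for i y
  proof -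
    obtain M where irrM: "\<forall>\<phi>\<in>#M. irreducible_character \<phi>"
      and M: "char_power \<chi> i = (\<lambda>x. \<Sum>\<phi>\<in>#M. \<phi> x)"
      using powers[of i] trace_is_sum_of_irreducible_characters unfolding character_def by metis
    then have "\<psi> \<notin># M"
      using not_comp[OF i] by (auto simp: irreducible_component_def)
    then have "\<phi> (x * y) = 0" if "\<phi> \<in># M" for \<phi>
      using that irrM char0 by blast
    then show ?thesis by (auto intro!: sum_mset.neutral simp: M)
  qed
  obtain c where "\<And>x. representation B x 1 = (\<Sum>i\<le>k - 1. c i * char_power \<chi> i x)"
    using coordinate_at_one_as_combination_of_powers[OF ker k] by blast
  then have "representation B (x * y) 1 = 0" for y
    using power0 by simp
  then have "x = 0" by (rule coordinate_at_one_nondegenerate)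
  moreover have "R 0 = 0\<^sub>m n n"
  proof -
    have scale: "R (c *\<^sub>A x) = c \<cdot>\<^sub>m R x" and Rx: "R x \<in> carrier_mat n n" for c
      using R by (auto simp: irreducible_representation_def representation_of_degree_def)
    have "0 \<cdot>\<^sub>m R x = 0\<^sub>m n n" using Rx by (intro eq_matI) auto
    then show ?thesis using scale[of 0] by simp
  qed
  ultimately show False using Rx by simp
qed

end

theorem theorem4p5:
  fixes scale :: "complex \<Rightarrow> 'a::ring_1 \<Rightarrow> 'a"
    and B :: "'a set"
    and star :: "'a \<Rightarrow> 'a"
    and deg :: "'a \<Rightarrow> real"
    and \<chi> :: "'a \<Rightarrow> complex"
    and k :: nat
  assumes "table_algebra scale B star deg"
    and "complex_algebra.character scale \<chi>"
    and "table_algebra.char_kernel B deg \<chi> = {1}"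
    and "card ((\<lambda>b. \<chi> b / complex_of_real (deg b)) ` B) = k"
    and "\<forall>j. complex_algebra.character scale (table_algebra.char_power scale B deg \<chi> j)"
  shows "\<forall>\<psi>. complex_algebra.irreducible_character scale \<psi> \<longrightarrow>
           (\<exists>i\<in>{0..k - 1}. complex_algebra.irreducible_component scale \<psi>
              (table_algebra.char_power scale B deg \<chi> i))"
proof -
  interpret table_algebra scale B star deg by (rule assms(1))
  show ?thesis
  proof (intro allI impI)
    fix \<psi> assume "irreducible_character \<psi>"
    then show "\<exists>i\<in>{0..k - 1}. irreducible_component \<psi> (char_power \<chi> i)"
      by (rule irreducible_in_some_power[OF assms(3,4) assms(5)[rule_format]])
  qed
qed

end
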